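(* For each algebraic integer $\theta\in\overline{\mathbb{Q}}\setminus\mathbb{Q}$, let $C(\theta)$ be the set of all $\gamma\in\overline{\mathbb{Q}}\setminus\mathbb{Q}$ whose numerator is equal to $\theta$. Then the classes $C(\theta)$ form a partition of $\overline{\mathbb{Q}}\setminus\mathbb{Q}$, and each class $C(\theta)$ contains only finitely many Arno et al. numbers.
   Context: Let $\gamma\in\overline{\mathbb{Q}}$ be an algebraic number of degree $n$. Its minimal polynomial over $\mathbb{Z}$ is the unique polynomial $g(x)=c_nx^n+\cdots+c_1x+c_0\in\mathbb{Z}[x]$, irreducible in $\mathbb{Z}[x]$ (in particular primitive), with $g(\gamma)=0$ and $c_n>0$. The leading coefficient of $\gamma$ is $c(\gamma)=c_n$. The denominator $d(\gamma)$ of $\gamma$ is the smallest positive integer $d$ such that $d\gamma$ is an algebraic integer (equivalently, the positive generator of the ideal $\{k\in\mathbb{Z}: k\gamma \text{ is an algebraic integer}\}$ of $\mathbb{Z}$). The numerator of $\gamma$ is the algebraic integer $d(\gamma)\gamma$. An algebraic number $\gamma$ is called an Arno et al. number if $c(\gamma)=d(\gamma)$. *)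

theory Defs
  imports
    Complex_Main
    "HOL-Library.Disjoint_Sets"
    "HOL-Computational_Algebra.Computational_Algebra"
begin

text \<open>The algebraic closure of the rationals is taken inside the complex numbers.\<close>

definition irrational_algebraics :: "complex set" where
  "irrational_algebraics = {\<gamma>. algebraic \<gamma>} - \<rat>"

text \<open>
  Irreducibility is in the ring of integer polynomials, so it entails primitivity. The
  description is only meaningful for algebraic arguments.
\<close>

definition int_min_poly :: "complex \<Rightarrow> int poly" where
  "int_min_poly \<gamma> =
     (THE g. irreducible g \<and> poly (map_poly of_int g) \<gamma> = 0 \<and> lead_coeff g > 0)"

definition leading_coefficient :: "complex \<Rightarrow> int" where
  "leading_coefficient \<gamma> = lead_coeff (int_min_poly \<gamma>)"

definition denominator :: "complex \<Rightarrow> nat" where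
  "denominator \<gamma> = (LEAST d. d > 0 \<and> algebraic_int (of_nat d * \<gamma>))"

definition numerator :: "complex \<Rightarrow> complex" where
  "numerator \<gamma> = of_nat (denominator \<gamma>) * \<gamma>"

definition Arno_et_al :: "complex \<Rightarrow> bool" where
  "Arno_et_al \<gamma> \<longleftrightarrow> algebraic \<gamma> \<and> leading_coefficient \<gamma> = int (denominator \<gamma>)"

definition numerator_class :: "complex \<Rightarrow> complex set" where
  "numerator_class \<theta> = {\<gamma> \<in> irrational_algebraics. numerator \<gamma> = \<theta>}"

end

theory Submission
  imports Defs
begin

text \<open>
  Suppose \<open>\<gamma>\<close> has numerator \<open>\<theta>\<close> and \<open>d = d(\<gamma>) = c(\<gamma>)\<close>, and let \<open>f\<close>, \<open>g\<close> be the minimal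
  polynomials of \<open>\<theta>\<close>, \<open>\<gamma> = \<theta> / d\<close>. Both have the same degree \<open>m \<ge> 2\<close>, and \<open>g\<close> divides \<open>f(d x)\<close>
  over the integers, so \<open>f(d x) = q g(x)\<close> with a constant \<open>q\<close>. Comparing leading coefficients,
  \<open>d\<^sup>m lead(f) = q d\<close>, so \<open>d\<close> divides \<open>q\<close> and hence \<open>f(0) = q g(0)\<close>. As \<open>f(0) \<noteq> 0\<close> depends on \<open>\<theta>\<close>
  only, there are finitely many such \<open>d\<close>, and \<open>d\<close> determines \<open>\<gamma>\<close>.
\<close>

section \<open>Evaluating integer polynomials at complex numbers\<close>

abbreviation ipoly :: "int poly \<Rightarrow> complex \<Rightarrow> complex" where
  "ipoly p x \<equiv> poly (map_poly of_int p) x"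

lemma ipoly_add: "ipoly (p + q) x = ipoly p x + ipoly q x"
proof -
  have "map_poly of_int (p + q) = (map_poly of_int p + map_poly of_int q :: complex poly)"
    by (rule poly_eqI) (simp add: coeff_map_poly)
  then show ?thesis by simp
qed

lemma ipoly_mult: "ipoly (p * q) x = ipoly p x * ipoly q x"
proof -
  have "map_poly of_int (p * q) = (map_poly of_int p * map_poly of_int q :: complex poly)"
    by (rule poly_eqI) (simp add: coeff_map_poly coeff_mult)
  then show ?thesis by simp
qed

lemma ipoly_pCons: "ipoly (pCons a p) x = of_int a + x * ipoly p x"
  by (simp add: map_poly_pCons)

lemma ipoly_smult: "ipoly (smult a p) x = of_int a * ipoly p x"
  using ipoly_mult[of "[:a:]" p x] by (simp add: ipoly_pCons)

lemma ipoly_sum: "ipoly (sum f A) x = (\<Sum>i\<in>A. ipoly (f i) x)"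
  by (induction A rule: infinite_finite_induct) (simp_all add: ipoly_add)

lemma ipoly_monom: "ipoly (monom a n) x = of_int a * x ^ n"
  by (simp add: map_poly_monom poly_monom)

lemma ipoly_altdef: "ipoly p x = (\<Sum>i\<le>degree p. of_int (coeff p i) * x ^ i)"
  by (subst poly_as_sum_of_monoms[of p, symmetric]) (simp only: ipoly_sum ipoly_monom)

lemma ipoly_pcompose_linear: "ipoly (pcompose p [:0, c:]) x = ipoly p (of_int c * x)"
  by (induction p) (simp_all add: pcompose_pCons ipoly_add ipoly_mult ipoly_pCons del: mult_pCons_left)

section \<open>Minimal polynomials over the integers\<close>

text \<open>Normalise an integer polynomial of least degree among the nonzero ones vanishing at
  \<gamma>. Pseudo-division and Gauss's lemma make it divide all others over the integers, and
  irreducibility follows from that.\<close>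

lemma algebraic_imp_minimal_ipoly:
  assumes "algebraic \<gamma>"
  obtains m where "irreducible m" "ipoly m \<gamma> = 0" "lead_coeff m > 0"
    "\<And>p. ipoly p \<gamma> = 0 \<Longrightarrow> m dvd p"
proof -
  let ?P = "\<lambda>p. p \<noteq> 0 \<and> ipoly p \<gamma> = 0"
  obtain p0 where p0: "?P p0"
    using assms by (auto elim: algebraicE')
  define p where "p = arg_min degree ?P"
  have p: "?P p" and le: "degree p \<le> degree q" if "?P q" for q
    using arg_min_nat_lemma[of ?P p0 degree] p0 that unfolding p_def by auto
  from p[OF p0] have p': "p \<noteq> 0" "ipoly p \<gamma> = 0" by auto
  \<comment> \<open>Contents are positive, so the primitive part keeps the sign of the leading
    coefficient; the factor \<open>sgn\<close> makes it positive.\<close>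
  define m where "m = smult (sgn (lead_coeff p)) (primitive_part p)"
  have pp: "smult (content p) (primitive_part p) = p" by simp
  have cp: "content p > 0"
    using p'(1) by (metis content_eq_zero_iff normalize_content abs_ge_zero normalize_int_def order_le_less)
  have lp: "lead_coeff p = content p * lead_coeff (primitive_part p)"
    by (metis pp lead_coeff_smult)
  have sg: "sgn (lead_coeff p) \<noteq> 0" using p' by (simp add: sgn_eq_0_iff)
  have "ipoly (primitive_part p) \<gamma> = 0"
    using p'(2) cp by (metis pp ipoly_smult mult_eq_0_iff of_int_eq_0_iff less_irrefl)
  then have mroot: "ipoly m \<gamma> = 0" by (simp add: m_def ipoly_smult)
  have mlead: "lead_coeff m > 0"
    using cp p' lp by (auto simp: m_def sgn_if zero_less_mult_iff mult_less_0_iff degree_primitive_part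
        simp del: content_times_primitive_part)
  have mdeg: "degree m = degree p" using sg by (simp add: m_def)
  have mprim: "content m = 1" using p' sg by (simp add: m_def sgn_if)
  have dvd: "m dvd r" if r: "ipoly r \<gamma> = 0" for r
  proof -
    have m0: "m \<noteq> 0" using mlead by auto
    \<comment> \<open>Division with remainder over the integers requires scaling \<open>r\<close> by
      some nonzero \<open>a\<close>. The remainder vanishes at \<gamma>, so minimality of the degree
      forces it to be 0.\<close>
    obtain a q where aq: "a \<noteq> 0" "smult a r = m * q + pseudo_mod r m"
      using pseudo_mod(1)[OF m0] by blast
    have "ipoly (pseudo_mod r m) \<gamma> = 0"
      using arg_cong[OF aq(2), of "\<lambda>p. ipoly p \<gamma>"] r mroot
      by (simp add: ipoly_smult ipoly_add ipoly_mult)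
    then have "pseudo_mod r m = 0"
      using pseudo_mod(2)[OF m0, of r] le[of "pseudo_mod r m"] mdeg by fastforce
    with aq have "m dvd smult a r" by simp
    \<comment> \<open>By Gauss's lemma, passing to primitive parts removes the scalar
      \<open>a\<close> up to sign.\<close>
    then have "primitive_part m dvd primitive_part (smult a r)" by (rule primitive_part_dvd_primitive_partI)
    then have "m dvd smult (unit_factor a) (primitive_part r)"
      using mprim by (simp add: primitive_part_prim primitive_part_smult)
    then have "m dvd primitive_part r"
      using aq(1) by (simp add: sgn_if split: if_splits)
    then show ?thesis
      by (metis content_times_primitive_part dvd_smult)
  qed
  \<comment> \<open>In a factorisation of \<open>m\<close>, one factor vanishes at \<gamma>; it is
    then a multiple of \<open>m\<close>, which leaves a unit for the other.\<close>
  have unit: "b dvd 1" if ab: "m = a * b" and a: "ipoly a \<gamma> = 0" for a b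
  proof -
    from dvd[OF a] obtain c where c: "a = m * c" by (elim dvdE)
    have "m * (c * b) = m * 1" using ab c by (simp add: ac_simps)
    then have "c * b = 1" using mlead by (subst (asm) mult_left_cancel) auto
    then show ?thesis by (metis dvd_triv_right)
  qed
  have "irreducible m"
  proof (rule irreducibleI)
    show "m \<noteq> 0" using mlead by auto
    show "\<not> m dvd 1"
    proof
      assume "m dvd 1"
      then obtain c where "1 = m * c" by (elim dvdE)
      from arg_cong[OF this, of "\<lambda>p. ipoly p \<gamma>"] mroot show False by (simp add: ipoly_mult)
    qed
    show "a dvd 1 \<or> b dvd 1" if "m = a * b" for a b
      using that unit[of a b] unit[of b a] mroot by (auto simp: ipoly_mult mult.commute)
  qed
  with mroot mlead dvd that show ?thesis by blast
qed

text \<open>Any other candidate is a multiple of \<open>m\<close>; by irreducibility the cofactor is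
  a unit, and positive leading coefficients make it 1. Hence the definite description denotes
  \<open>m\<close>.\<close>

lemma int_min_poly:
  assumes "algebraic \<gamma>"
  shows "irreducible (int_min_poly \<gamma>)" "ipoly (int_min_poly \<gamma>) \<gamma> = 0"
    "lead_coeff (int_min_poly \<gamma>) > 0" "\<And>p. ipoly p \<gamma> = 0 \<Longrightarrow> int_min_poly \<gamma> dvd p"
proof -
  obtain m where m: "irreducible m" "ipoly m \<gamma> = 0" "lead_coeff m > 0"
    "\<And>p. ipoly p \<gamma> = 0 \<Longrightarrow> m dvd p"
    by (rule algebraic_imp_minimal_ipoly[OF assms]) blast
  have "int_min_poly \<gamma> = m"
    unfolding int_min_poly_def
  proof (rule the_equality)
    fix g assume g: "irreducible g \<and> ipoly g \<gamma> = 0 \<and> 0 < lead_coeff g"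
    then obtain c where c: "g = m * c" using m(4) by (auto elim: dvdE)
    with g m(1) have "c dvd 1" by (auto simp: irreducible_def)
    then obtain k where k: "c = [:k:]" "k dvd 1" by (auto simp: is_unit_poly_iff)
    with c g m(3) have "k > 0" by (auto simp: zero_less_mult_iff)
    with k c show "g = m" by (simp add: one_pCons[symmetric])
  qed (use m in auto)
  with m show "irreducible (int_min_poly \<gamma>)" "ipoly (int_min_poly \<gamma>) \<gamma> = 0"
    "lead_coeff (int_min_poly \<gamma>) > 0" "\<And>p. ipoly p \<gamma> = 0 \<Longrightarrow> int_min_poly \<gamma> dvd p"
    by auto
qed

lemma degree_int_min_poly_ge_2:
  assumes "\<gamma> \<in> irrational_algebraics"
  shows "degree (int_min_poly \<gamma>) \<ge> 2"
proof (rule ccontr)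
  let ?g = "int_min_poly \<gamma>"
  from assms have alg: "algebraic \<gamma>" and irr: "\<gamma> \<notin> \<rat>"
    by (auto simp: irrational_algebraics_def)
  assume "\<not> degree ?g \<ge> 2"
  moreover obtain a q where aq: "?g = pCons a q" by (rule pCons_cases)
  ultimately have "degree q = 0" by (simp split: if_splits)
  with aq obtain b where ab: "?g = [:a, b:]" by (auto elim: degree_eq_zeroE)
  from int_min_poly(2)[OF alg] have eq: "of_int a + \<gamma> * of_int b = 0"
    unfolding ab by (simp add: ipoly_pCons)
  show False
  proof (cases "b = 0")
    case True
    with eq ab int_min_poly(3)[OF alg] show False by simp
  next
    case False
    with eq have "\<gamma> = - of_int a / of_int b" by (simp add: field_simps add_eq_0_iff)
    with irr show False by auto
  qed
qed

text \<open>Otherwise x could be split off, and the cofactor would still vanish at \<theta> with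
  smaller degree.\<close>

lemma coeff_0_int_min_poly_neq_0:
  assumes "algebraic \<theta>" "\<theta> \<noteq> 0"
  shows "coeff (int_min_poly \<theta>) 0 \<noteq> 0"
proof
  let ?f = "int_min_poly \<theta>"
  assume "coeff ?f 0 = 0"
  then obtain q where q: "?f = pCons 0 q" by (cases ?f) auto
  then have f: "?f = q * [:0, 1:]" by simp
  from int_min_poly(2)[OF assms(1)] assms(2) have "ipoly q \<theta> = 0"
    unfolding q by (simp add: ipoly_pCons)
  from int_min_poly(4)[OF assms(1) this] have "degree ?f \<le> degree q" if "q \<noteq> 0"
    using that by (rule dvd_imp_degree_le)
  with q int_min_poly(1)[OF assms(1)] show False
    by (cases "q = 0") auto
qed

section \<open>Comparing the minimal polynomials of a number and an integer multiple\<close>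

lemma degree_int_min_poly_of_int_mult_le:
  assumes alg: "algebraic \<gamma>" "algebraic (of_int d * \<gamma>)"
  shows "degree (int_min_poly (of_int d * \<gamma>)) \<le> degree (int_min_poly \<gamma>)"
proof -
  let ?g = "int_min_poly \<gamma>"
  define n where "n = degree ?g"
  \<comment> \<open>This is d^n g(x/d) with denominators cleared. Its coefficient at
    \<open>n\<close> gets the factor d^0, so it stays nonzero.\<close>
  define p where "p = (\<Sum>i\<le>n. monom (coeff ?g i * d ^ (n - i)) i)"
  have "ipoly p (of_int d * \<gamma>) = (\<Sum>i\<le>n. of_int d ^ n * (of_int (coeff ?g i) * \<gamma> ^ i))"
    unfolding p_def ipoly_sum ipoly_monom
  proof (rule sum.cong)
    fix i assume "i \<in> {..n}"
    then have "(of_int d :: complex) ^ n = of_int d ^ (n - i) * of_int d ^ i"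
      by (simp flip: power_add)
    then show "of_int (coeff ?g i * d ^ (n - i)) * (of_int d * \<gamma>) ^ i =
        of_int d ^ n * (of_int (coeff ?g i) * \<gamma> ^ i)"
      by (simp add: power_mult_distrib)
  qed simp
  also have "\<dots> = of_int d ^ n * ipoly ?g \<gamma>"
    by (simp add: ipoly_altdef n_def sum_distrib_left)
  finally have "int_min_poly (of_int d * \<gamma>) dvd p"
    using int_min_poly(2)[OF alg(1)] by (intro int_min_poly(4) alg) simp
  moreover have "coeff p n = lead_coeff ?g"
    by (simp add: p_def coeff_sum n_def)
  then have "p \<noteq> 0" using int_min_poly(3)[OF alg(1)] by auto
  moreover have "degree p \<le> n"
    unfolding p_def by (intro degree_sum_le) (auto intro: order.trans[OF degree_monom_le])
  ultimately show ?thesis unfolding n_def by (meson dvd_imp_degree_le order.trans)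
qed

lemma lead_coeff_int_min_poly_dvd:
  assumes \<theta>: "\<theta> \<in> irrational_algebraics" and alg: "algebraic \<gamma>"
    and eq: "\<theta> = of_int (lead_coeff (int_min_poly \<gamma>)) * \<gamma>"
  shows "lead_coeff (int_min_poly \<gamma>) dvd coeff (int_min_poly \<theta>) 0"
proof -
  define f where "f = int_min_poly \<theta>"
  define g where "g = int_min_poly \<gamma>"
  define d where "d = lead_coeff g"
  define F where "F = pcompose f [:0, d:]"
  have alg\<theta>: "algebraic \<theta>" using \<theta> by (simp add: irrational_algebraics_def)
  have d: "d > 0" using int_min_poly(3)[OF alg] by (simp add: d_def g_def)
  have eq': "\<theta> = of_int d * \<gamma>" using eq by (simp add: d_def g_def)
  have deg2: "degree f \<ge> 2" using degree_int_min_poly_ge_2[OF \<theta>] by (simp add: f_def)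
  have degF: "degree F = degree f" using d by (simp add: F_def degree_pcompose)
  have leadF: "lead_coeff F = lead_coeff f * d ^ degree f"
    using d unfolding F_def by (subst lead_coeff_comp) auto
  have "ipoly F \<gamma> = 0"
    using int_min_poly(2)[OF alg\<theta>] by (simp add: F_def ipoly_pcompose_linear f_def eq')
  then obtain q where q: "F = g * q"
    using int_min_poly(4)[OF alg] unfolding g_def by (auto elim: dvdE)
  have "F \<noteq> 0" using degF deg2 by auto
  then have "degree F = degree g + degree q" using q by (auto simp: degree_mult_eq)
  \<comment> \<open>Since \<open>F = g * q\<close> has the degree of \<open>f\<close>, this
    inequality leaves degree 0 for \<open>q\<close>.\<close>
  moreover have "degree f \<le> degree g"
    using degree_int_min_poly_of_int_mult_le[of \<gamma> d] alg alg\<theta> unfolding eq' f_def g_def by simp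
  ultimately have "degree q = 0" using degF by simp
  then obtain k where k: "q = [:k:]" by (rule degree_eq_zeroE)
  have "d * k = d * (lead_coeff f * d ^ (degree f - 1))"
  proof -
    have "d * k = lead_coeff F"
      using q k by (simp add: d_def lead_coeff_mult mult.commute)
    moreover have "d ^ degree f = d * d ^ (degree f - 1)"
      using deg2 by (simp flip: power_Suc)
    ultimately show ?thesis using leadF by simp
  qed
  then have "k = lead_coeff f * d ^ (degree f - 1)" using d by simp
  \<comment> \<open>Irrationality of \<theta> enters here: the exponent \<open>degree f - 1\<close>
    is at least 1.\<close>
  then have "d dvd k" using deg2 by (simp add: dvd_power)
  moreover have "coeff f 0 = coeff g 0 * k"
    using arg_cong[OF q, of "\<lambda>p. coeff p 0"] k by (simp add: F_def poly_0_coeff_0)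
  ultimately show ?thesis by (simp add: f_def g_def d_def)
qed

section \<open>Denominators and numerators\<close>

text \<open>Multiplying p(x) = 0 by a^(n-1), with \<open>a\<close> the leading coefficient, turns it
  into a monic integer equation for a x.\<close>

lemma algebraic_int_lead_coeff_mult:
  assumes "ipoly p x = 0" "p \<noteq> 0"
  shows "algebraic_int (of_int (lead_coeff p) * x)"
proof -
  define n where "n = degree p"
  define a where "a = lead_coeff p"
  have a: "a \<noteq> 0" using assms by (simp add: a_def)
  have n: "n \<noteq> 0"
  proof
    assume "n = 0"
    then obtain c where "p = [:c:]" unfolding n_def by (rule degree_eq_zeroE)
    with assms show False by (simp add: ipoly_pCons)
  qed
  \<comment> \<open>In the variable y = a x this is a^(n-1) p(y/a): the top term becomes y^n, and
    the other exponents of \<open>a\<close> are n-1-i.\<close>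
  define h where "h = monom 1 n + (\<Sum>i<n. monom (coeff p i * a ^ (n - 1 - i)) i)"
  have "degree (\<Sum>i<n. monom (coeff p i * a ^ (n - 1 - i)) i) < n"
    using n by (intro degree_sum_less) (auto intro: order.strict_trans1[OF degree_monom_le])
  then have lead: "lead_coeff h = 1"
    by (simp add: h_def degree_add_eq_left degree_monom_eq coeff_eq_0 del: coeff_sum)
  have "ipoly h (of_int a * x) =
      (of_int a * x) ^ n + (\<Sum>i<n. of_int a ^ (n - 1) * (of_int (coeff p i) * x ^ i))"
    unfolding h_def ipoly_add ipoly_sum ipoly_monom
  proof (intro arg_cong2[of _ _ _ _ "(+)"] sum.cong)
    fix i assume "i \<in> {..<n}"
    then have "(of_int a :: complex) ^ (n - 1) = of_int a ^ (n - 1 - i) * of_int a ^ i"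
      by (simp flip: power_add)
    then show "of_int (coeff p i * a ^ (n - 1 - i)) * (of_int a * x) ^ i =
        of_int a ^ (n - 1) * (of_int (coeff p i) * x ^ i)"
      by (simp add: power_mult_distrib)
  qed simp_all
  also have "(of_int a * x) ^ n = of_int a ^ (n - 1) * (of_int (coeff p n) * x ^ n)"
  proof -
    have "(of_int a :: complex) ^ n = of_int a ^ (n - 1) * of_int a"
      using n by (subst power_minus_mult) auto
    then show ?thesis by (simp add: power_mult_distrib a_def n_def)
  qed
  also have "\<dots> + (\<Sum>i<n. of_int a ^ (n - 1) * (of_int (coeff p i) * x ^ i)) =
      of_int a ^ (n - 1) * ipoly p x"
    by (simp add: ipoly_altdef n_def[symmetric] sum_distrib_left distrib_left flip: lessThan_Suc_atMost)
  finally show ?thesis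
    using lead assms(1) unfolding algebraic_int_altdef_ipoly a_def by auto
qed

lemma denominator:
  assumes "algebraic \<gamma>"
  shows "denominator \<gamma> > 0" "algebraic_int (numerator \<gamma>)"
proof -
  let ?c = "lead_coeff (int_min_poly \<gamma>)"
  have "?c > 0" using int_min_poly(3)[OF assms] .
  moreover from this have "algebraic_int (of_int ?c * \<gamma>)"
    using int_min_poly(2)[OF assms] by (intro algebraic_int_lead_coeff_mult) auto
  \<comment> \<open>The leading coefficient is a witness, so the \<open>LEAST\<close> in
    \<open>denominator\<close> ranges over a nonempty set.\<close>
  ultimately have "\<exists>d::nat. d > 0 \<and> algebraic_int (of_nat d * \<gamma>)"
    by (intro exI[of _ "nat ?c"]) simp
  from LeastI_ex[OF this] show "denominator \<gamma> > 0" "algebraic_int (numerator \<gamma>)"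
    by (simp_all add: denominator_def numerator_def)
qed

text \<open>The least possible denominator 1 already works. This puts each irrational algebraic
  integer in its own class, so no class is empty.\<close>

lemma numerator_algebraic_int:
  assumes "algebraic_int \<theta>"
  shows "numerator \<theta> = \<theta>"
proof -
  have "denominator \<theta> = 1"
    unfolding denominator_def using assms by (intro Least_equality) auto
  then show ?thesis by (simp add: numerator_def)
qed

lemma numerator_irrational_algebraic:
  assumes "\<gamma> \<in> irrational_algebraics"
  shows "numerator \<gamma> \<in> irrational_algebraics"
proof -
  from assms have alg: "algebraic \<gamma>" and irr: "\<gamma> \<notin> \<rat>"
    by (auto simp: irrational_algebraics_def)
  have "numerator \<gamma> \<notin> \<rat>"
  proof
    assume "numerator \<gamma> \<in> \<rat>"
    then have "numerator \<gamma> / of_nat (denominator \<gamma>) \<in> \<rat>" by (intro Rats_divide) auto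
    with irr denominator(1)[OF alg] show False by (simp add: numerator_def)
  qed
  with denominator(2)[OF alg] show ?thesis by (auto simp: irrational_algebraics_def)
qed

section \<open>Finiteness in each class, and the partition\<close>

lemma finite_Arno_et_al_numerator_class:
  assumes "\<theta> \<in> irrational_algebraics"
  shows "finite {\<gamma> \<in> numerator_class \<theta>. Arno_et_al \<gamma>}"
proof (rule finite_subset)
  let ?D = "{d::int. d dvd coeff (int_min_poly \<theta>) 0}"
  from assms have "algebraic \<theta>" "\<theta> \<noteq> 0" by (auto simp: irrational_algebraics_def)
  then have "coeff (int_min_poly \<theta>) 0 \<noteq> 0" by (rule coeff_0_int_min_poly_neq_0)
  then have "finite ?D" by simp
  \<comment> \<open>A member of the class is recovered from its denominator \<open>d\<close> as
    \<theta> / d, so finitely many candidates for \<open>d\<close> suffice.\<close>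
  then show "finite ((\<lambda>d. \<theta> / of_int d) ` ?D)" by (rule finite_imageI)
  show "{\<gamma> \<in> numerator_class \<theta>. Arno_et_al \<gamma>} \<subseteq> (\<lambda>d. \<theta> / of_int d) ` ?D"
  proof (intro subsetI, elim CollectE conjE)
    fix \<gamma> assume \<gamma>: "\<gamma> \<in> numerator_class \<theta>" and A: "Arno_et_al \<gamma>"
    have alg: "algebraic \<gamma>" using A by (simp add: Arno_et_al_def)
    have lead: "lead_coeff (int_min_poly \<gamma>) = int (denominator \<gamma>)"
      using A by (simp add: Arno_et_al_def leading_coefficient_def)
    have eq: "\<theta> = of_nat (denominator \<gamma>) * \<gamma>"
      using \<gamma> by (simp add: numerator_class_def numerator_def)
    have "int (denominator \<gamma>) \<in> ?D"
      using lead_coeff_int_min_poly_dvd[OF assms alg] lead eq by simp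
    moreover have "\<gamma> = \<theta> / of_int (int (denominator \<gamma>))"
      using eq denominator(1)[OF alg] by simp
    ultimately show "\<gamma> \<in> (\<lambda>d. \<theta> / of_int d) ` ?D" by blast
  qed
qed

theorem mainTheorem2:
  shows "partition_on irrational_algebraics
           (numerator_class ` {\<theta> \<in> irrational_algebraics. algebraic_int \<theta>}) \<and>
         (\<forall>\<theta> \<in> irrational_algebraics. algebraic_int \<theta> \<longrightarrow>
           finite {\<gamma> \<in> numerator_class \<theta>. Arno_et_al \<gamma>})"
proof (intro conjI ballI impI)
  let ?I = "{\<theta> \<in> irrational_algebraics. algebraic_int \<theta>}"
  show "partition_on irrational_algebraics (numerator_class ` ?I)"
  proof (rule partition_onI)
    show "\<Union>(numerator_class ` ?I) = irrational_algebraics"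
    proof
      show "irrational_algebraics \<subseteq> \<Union>(numerator_class ` ?I)"
      proof
        fix \<gamma> assume \<gamma>: "\<gamma> \<in> irrational_algebraics"
        then have "algebraic_int (numerator \<gamma>)"
          by (intro denominator) (simp add: irrational_algebraics_def)
        with \<gamma> numerator_irrational_algebraic[OF \<gamma>] show "\<gamma> \<in> \<Union>(numerator_class ` ?I)"
          by (auto simp: numerator_class_def)
      qed
    qed (auto simp: numerator_class_def)
    \<comment> \<open>A common element has only one numerator, which would make the two classes
      equal.\<close>
    show "disjnt p q" if "p \<in> numerator_class ` ?I" "q \<in> numerator_class ` ?I" "p \<noteq> q" for p q
      using that by (auto simp: numerator_class_def disjnt_def)
    have "\<theta> \<in> numerator_class \<theta>" if "\<theta> \<in> ?I" for \<theta>
      using that by (simp add: numerator_class_def numerator_algebraic_int)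
    then show "{} \<notin> numerator_class ` ?I" by blast
  qed
qed (rule finite_Arno_et_al_numerator_class)

end
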